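(* Let $a>0$, $\phi_a(t)=\exp\{-4a^2\sin^2(\pi t)\}$ and $G_a(t,t')=\phi_a(t-t')$ for $t,t'\in[0,1]$. Then $\phi_a(t)=\int e^{-its}\,d\mu_a(s)$, where $\mu_a$ is a symmetric and finite measure given by $$\mu_a=\sum_{n=-\infty}^\infty e^{-2a^2}I_n(2a^2)\,\delta_{2\pi n}.$$ In addition, the Karhunen–Loève expansion of the covariance kernel is $G_a(t,t')=\sum_{k=1}^\infty v_k(a)\psi_k(t)\psi_k(t')$, where the eigenvalues are given by $$v_1(a)=e^{-2a^2}I_0(2a^2),\qquad v_{2j}(a)=v_{2j+1}(a)=e^{-2a^2}I_j(2a^2),\quad j\ge1,$$ with eigenfunctions $\psi_k(t)$, $k=1,2,\dots$, given by the orthonormal Fourier basis functions $1,\ \sqrt2\cos2\pi t,\ \sqrt2\sin2\pi t,\ \sqrt2\cos4\pi t,\ \sqrt2\sin4\pi t,\dots$ in that order.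
   Context: $I_n(x)$ denotes the modified Bessel function of the first kind of integer order $n$; $\delta_x$ is the unit point mass at $x$. $G_a$ is called the squared exponential periodic (SEP) kernel on $[0,1]$. *)

theory Defs
  imports "HOL-Probability.Probability"
begin

text \<open>The series is the usual one for real order \<open>\<nu>\<close>, namely the sum of
  \<open>(x/2)^(2m+\<nu>) / (m! \<Gamma>(m+\<nu>+1))\<close>. The function \<^const>\<open>rGamma\<close> is the entire function
  \<open>1/\<Gamma>\<close>, so for negative integer orders the terms with \<open>m + n < 0\<close> vanish.\<close>

definition bessel_I :: "int \<Rightarrow> real \<Rightarrow> real" where
  "bessel_I n x =
     (\<Sum>m::nat. (x / 2) powi (2 * int m + n) * rGamma (real_of_int (int m + n + 1)) / fact m)"

lemma rGamma_int_bounds: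
  "0 \<le> rGamma (real_of_int k)" "rGamma (real_of_int k) \<le> 1"
proof -
  have "0 \<le> rGamma (real_of_int k) \<and> rGamma (real_of_int k) \<le> 1"
  proof (cases "k \<le> 0")
    case True
    then have "real_of_int k \<in> \<int>\<^sub>\<le>\<^sub>0" by (simp add: nonpos_Ints_def)
    then have "rGamma (real_of_int k) = 0" by (simp only: rGamma_eq_zero_iff)
    then show ?thesis by simp
  next
    case False
    then have "k = int (Suc (nat (k - 1)))" by simp
    then obtain j where j: "k = int (Suc j)" by blast
    have "real_of_int k = 1 + real j" using j by simp
    then have "rGamma (real_of_int k) = inverse (fact j)"
      by (simp only: rGamma_inverse_Gamma Gamma_fact)
    then show ?thesis
      using fact_ge_1[of j, where 'a = real] by (simp add: inverse_le_1_iff)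
  qed
  then show "0 \<le> rGamma (real_of_int k)" "rGamma (real_of_int k) \<le> 1" by auto
qed

lemma bessel_I_summable:
  assumes "x > 0"
  shows "summable (\<lambda>m::nat. (x / 2) powi (2 * int m + n) * rGamma (real_of_int (int m + n + 1)) / fact m)"
proof (rule summable_comparison_test)
  show "summable (\<lambda>m::nat. (x / 2) powi n * (((x / 2)^2) ^ m /\<^sub>R fact m))"
    by (intro summable_mult summable_exp_generic)
  have split_powi: "(x / 2) powi (2 * int m + n) = (x / 2) powi n * ((x / 2)^2) ^ m" for m
  proof -
    have "(x / 2) powi (2 * int m) = ((x / 2)^2) ^ m"
      using power_int_of_nat[of "x / 2" "2 * m"] by (simp only: power_mult of_nat_mult of_nat_numeral)
    then show ?thesis using assms by (simp add: power_int_add)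
  qed
  then have "norm ((x / 2) powi (2 * int m + n) * rGamma (real_of_int (int m + n + 1)) / fact m)
      \<le> (x / 2) powi n * (((x / 2)^2) ^ m /\<^sub>R fact m)" for m
  proof -
    let ?c = "(x / 2) powi n * ((x / 2)^2) ^ m / fact m" and ?r = "rGamma (real_of_int (int m + n + 1))"
    have c: "0 \<le> ?c" using assms by simp
    have "norm (?c * ?r) = ?c * ?r"
      using c rGamma_int_bounds(1) by (simp only: real_norm_def abs_of_nonneg mult_nonneg_nonneg)
    also have "\<dots> \<le> ?c" using c rGamma_int_bounds(2) by (rule mult_left_le[rotated])
    finally have "norm (?c * ?r) \<le> ?c" .
    moreover have "(x / 2) powi (2 * int m + n) * ?r / fact m = ?c * ?r"
      unfolding split_powi by (simp only: times_divide_eq_left)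
    moreover have "(x / 2) powi n * (((x / 2)^2) ^ m /\<^sub>R fact m) = ?c"
      by (simp only: real_scaleR_def divide_inverse mult.assoc mult.commute[of "inverse (fact m)"])
    ultimately show ?thesis by (simp only:)
  qed
  then show "\<exists>N. \<forall>m\<ge>N. norm ((x / 2) powi (2 * int m + n) * rGamma (real_of_int (int m + n + 1)) / fact m)
      \<le> (x / 2) powi n * (((x / 2)^2) ^ m /\<^sub>R fact m)" by blast
qed

lemma bessel_I_nonneg:
  assumes "x > 0"
  shows "0 \<le> bessel_I n x"
  unfolding bessel_I_def
  by (intro suminf_nonneg bessel_I_summable assms divide_nonneg_nonneg mult_nonneg_nonneg
      rGamma_int_bounds zero_le_power_int) (use assms in auto)

definition sep_phi :: "real \<Rightarrow> real \<Rightarrow> real" where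
  "sep_phi a t = exp (- 4 * a\<^sup>2 * (sin (pi * t))\<^sup>2)"

definition sep_kernel :: "real \<Rightarrow> real \<Rightarrow> real \<Rightarrow> real" where
  "sep_kernel a t t' = sep_phi a (t - t')"

text \<open>The sum of weighted point masses is realised as the image, under \<open>n \<mapsto> 2 \<pi> n\<close>, of the
  weighted counting measure on the integers; the lemma below recovers the sum of point masses.
  By \<open>bessel_I_nonneg\<close> the weights are nonnegative, so \<^const>\<open>ennreal\<close> truncates nothing.\<close>

definition sep_spectral_measure :: "real \<Rightarrow> real measure" where
  "sep_spectral_measure a =
     distr (density (count_space UNIV) (\<lambda>n::int. ennreal (exp (- 2 * a\<^sup>2) * bessel_I n (2 * a\<^sup>2))))
       borel (\<lambda>n. 2 * pi * real_of_int n)"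

lemma emeasure_sep_spectral_measure:
  assumes "A \<in> sets borel"
  shows "emeasure (sep_spectral_measure a) A =
    (\<integral>\<^sup>+ n. ennreal (exp (- 2 * a\<^sup>2) * bessel_I n (2 * a\<^sup>2))
            * emeasure (return borel (2 * pi * real_of_int n)) A \<partial>count_space UNIV)"
  using assms unfolding sep_spectral_measure_def
  by (subst emeasure_distr)
     (auto simp: emeasure_density indicator_def intro!: nn_integral_cong)

definition square_integrable_unit :: "(real \<Rightarrow> real) \<Rightarrow> bool" where
  "square_integrable_unit f \<longleftrightarrow>
     f \<in> borel_measurable (lebesgue_on {0..1}) \<and> integrable (lebesgue_on {0..1}) (\<lambda>t. (f t)\<^sup>2)"

text \<open>Sequences are indexed by \<open>k \<ge> 1\<close>; the value at index 0 is ignored throughout. The last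
  condition says that the orthonormal system is complete in \<open>L\<^sup>2[0,1]\<close>.\<close>

definition orthonormal_basis_unit :: "(nat \<Rightarrow> real \<Rightarrow> real) \<Rightarrow> bool" where
  "orthonormal_basis_unit \<psi> \<longleftrightarrow>
     (\<forall>k\<ge>1. square_integrable_unit (\<psi> k)) \<and>
     (\<forall>j\<ge>1. \<forall>k\<ge>1. (\<integral>t. \<psi> j t * \<psi> k t \<partial>lebesgue_on {0..1}) = (if j = k then 1 else 0)) \<and>
     (\<forall>f. square_integrable_unit f \<and> (\<forall>k\<ge>1. (\<integral>t. f t * \<psi> k t \<partial>lebesgue_on {0..1}) = 0)
        \<longrightarrow> (AE t in lebesgue_on {0..1}. f t = 0))"

definition eigenpair_unit :: "(real \<Rightarrow> real \<Rightarrow> real) \<Rightarrow> real \<Rightarrow> (real \<Rightarrow> real) \<Rightarrow> bool" where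
  "eigenpair_unit K v f \<longleftrightarrow>
     (\<forall>t\<in>{0..1}. has_bochner_integral (lebesgue_on {0..1}) (\<lambda>s. K t s * f s) (v * f t))"

text \<open>The Karhunen-Loeve (Mercer) expansion of a covariance kernel on \<open>[0,1]\<close>: an orthonormal
  basis of eigenfunctions of the integral operator with kernel \<open>K\<close>, nonnegative eigenvalues, and
  the pointwise expansion of \<open>K\<close>.\<close>

definition karhunen_loeve_expansion ::
    "(real \<Rightarrow> real \<Rightarrow> real) \<Rightarrow> (nat \<Rightarrow> real) \<Rightarrow> (nat \<Rightarrow> real \<Rightarrow> real) \<Rightarrow> bool" where
  "karhunen_loeve_expansion K v \<psi> \<longleftrightarrow>
     orthonormal_basis_unit \<psi> \<and>
     (\<forall>k\<ge>1. 0 \<le> v k \<and> eigenpair_unit K (v k) (\<psi> k)) \<and>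
     (\<forall>t\<in>{0..1}. \<forall>t'\<in>{0..1}. (\<lambda>i. v (Suc i) * \<psi> (Suc i) t * \<psi> (Suc i) t') sums K t t')"

end

theory Submission
  imports Defs
begin

text \<open>
  Everything rests on the generating function
  \<open>exp (x/2 (z + 1/z)) = (\<Sum>n\<in>\<int>. I\<^sub>n(x) z\<^sup>n)\<close>, obtained by multiplying the two exponential series
  and collecting equal powers of \<open>z\<close> (\<open>bessel_I_generating_function\<close>). As
  \<open>- 4 a\<^sup>2 sin\<^sup>2(\<pi> t) = - 2 a\<^sup>2 + 2 a\<^sup>2 cos(2 \<pi> t)\<close>, taking \<open>x = 2 a\<^sup>2\<close> and \<open>z\<close> on the unit circle
  expands the SEP function into an absolutely convergent Fourier series whose coefficients
  \<open>exp (- 2 a\<^sup>2) I\<^sub>n(2 a\<^sup>2)\<close> are nonnegative, sum to \<open>1\<close> and are even in \<open>n\<close>. The spectral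
  measure is the measure with these weights, and the spectral representation is the same series.

  Pairing the frequencies \<open>n\<close> and \<open>-n\<close> and applying the addition theorem for the cosine to
  \<open>t - t'\<close> turns the series into the expansion of the kernel in the real Fourier basis
  (\<open>sep_kernel_expansion\<close>). It may be integrated term by term, so orthonormality makes the basis
  functions eigenfunctions (\<open>eigenpair_unit_of_expansion\<close>).

  What remains is completeness of the Fourier basis in \<open>L\<^sup>2[0,1]\<close>, proved here for all integrable
  functions. If all Fourier coefficients of \<open>f\<close> vanish, then \<open>f\<close> integrates to zero against
  every polynomial in the coordinates of the circle, hence by Stone--Weierstrass against every
  continuous \<open>g\<close> with \<open>g 0 = g 1\<close> (\<open>integral_times_loop_eq_0\<close>). The sign of \<open>f\<close> is a limit almost
  everywhere of such functions that are bounded by \<open>1\<close>, so dominated convergence gives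
  \<open>\<integral> \<bar>f\<bar> = 0\<close> (\<open>AE_eq_0_of_cis_moments\<close>).
\<close>

section \<open>The generating function of the modified Bessel functions\<close>

definition bessel_term :: "real \<Rightarrow> int \<Rightarrow> nat \<Rightarrow> real" where
  "bessel_term x n m = (x / 2) powi (2 * int m + n) * rGamma (real_of_int (int m + n + 1)) / fact m"

lemma rGamma_Suc_eq: "rGamma (real_of_int (int p + 1)) = 1 / fact p"
proof -
  have "real_of_int (int p + 1) = 1 + real p" by simp
  then show ?thesis by (simp only: rGamma_inverse_Gamma Gamma_fact inverse_eq_divide)
qed

text \<open>In the product of the exponential series of \<open>x z / 2\<close> and \<open>x / (2 z)\<close>, the pair \<open>(p, m)\<close>
  contributes to the power \<open>z\<^sup>p\<^sup>-\<^sup>m\<close>; its coefficient is the \<open>m\<close>-th term of the series for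
  \<open>I\<^sub>p\<^sub>-\<^sub>m(x)\<close>.\<close>

lemma bessel_term_diff:
  "bessel_term x (int p - int m) m = (x / 2) ^ p / fact p * ((x / 2) ^ m / fact m)"
proof -
  have e: "2 * int m + (int p - int m) = int (p + m)" "int m + (int p - int m) + 1 = int p + 1"
    by simp_all
  show ?thesis
    unfolding bessel_term_def e rGamma_Suc_eq power_int_of_nat by (simp add: power_add)
qed

lemma bessel_term_eq_0: "int m + n < 0 \<Longrightarrow> bessel_term x n m = 0"
proof -
  assume "int m + n < 0"
  then have "rGamma (real_of_int (int m + n + 1)) = 0"
    by (subst rGamma_eq_zero_iff) (simp add: nonpos_Ints_def del: of_int_add)
  then show ?thesis unfolding bessel_term_def by (simp del: of_int_add)
qed

lemma bessel_term_nonneg: "x > 0 \<Longrightarrow> 0 \<le> bessel_term x n m"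
  unfolding bessel_term_def by (intro divide_nonneg_nonneg mult_nonneg_nonneg
      rGamma_int_bounds zero_le_power_int) auto

lemma bessel_term_has_sum:
  assumes "x > 0" shows "(bessel_term x n has_sum bessel_I n x) UNIV"
proof (rule norm_summable_imp_has_sum)
  have s: "summable (bessel_term x n)"
    unfolding bessel_term_def[abs_def] by (rule bessel_I_summable[OF assms])
  then show "summable (\<lambda>m. norm (bessel_term x n m))"
    using bessel_term_nonneg[OF assms] by simp
  show "bessel_term x n sums bessel_I n x"
    using summable_sums[OF s] unfolding bessel_I_def bessel_term_def[abs_def] .
qed

lemma exp_product_has_sum:
  fixes u w :: complex
  shows "((\<lambda>(p, m). u ^ p / fact p * (w ^ m / fact m)) has_sum (exp u * exp w)) (UNIV \<times> UNIV)"
proof -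
  have e: "((\<lambda>p. c ^ p / fact p) has_sum exp c) UNIV" for c :: complex
    using norm_summable_imp_has_sum[OF summable_norm_exp exp_converges, of c]
    by (simp add: scaleR_conv_of_real divide_inverse mult.commute)
  have n: "(\<lambda>p. norm (c ^ p / fact p)) summable_on UNIV" for c :: complex
    using summable_norm_exp[of c] 
    by (subst summable_on_UNIV_nonneg_real_iff) (simp_all add: scaleR_conv_of_real divide_inverse mult.commute)
  have "(\<lambda>(p, m). norm (u ^ p / fact p) * norm (w ^ m / fact m)) summable_on UNIV \<times> UNIV"
  proof (rule summable_on_SigmaI, unfold prod.case)
    show "((\<lambda>m. norm (u ^ p / fact p) * norm (w ^ m / fact m)) has_sum
        norm (u ^ p / fact p) * infsum (\<lambda>m. norm (w ^ m / fact m)) UNIV) UNIV" for p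
      by (rule has_sum_cmult_right[OF has_sum_infsum[OF n]])
    show "(\<lambda>p. norm (u ^ p / fact p) * infsum (\<lambda>m. norm (w ^ m / fact m)) UNIV) summable_on UNIV"
      by (rule summable_on_cmult_left[OF n])
  qed (rule mult_nonneg_nonneg[OF norm_ge_zero norm_ge_zero])
  then have "(\<lambda>(p, m). u ^ p / fact p * (w ^ m / fact m)) summable_on UNIV \<times> UNIV"
    by - (rule abs_summable_summable, simp add: case_prod_unfold norm_mult norm_divide norm_power)
  moreover have "((\<lambda>m. u ^ p / fact p * (w ^ m / fact m)) has_sum (u ^ p / fact p * exp w)) UNIV" for p
    by (intro has_sum_cmult_right e)
  moreover have "((\<lambda>p. u ^ p / fact p * exp w) has_sum (exp u * exp w)) UNIV"
    by (intro has_sum_cmult_left e)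
  ultimately show ?thesis
    by (intro has_sum_SigmaI[where g = "\<lambda>p. u ^ p / fact p * exp w"]) simp_all
qed

theorem bessel_I_generating_function:
  fixes z :: complex
  assumes x: "x > 0" and z: "z \<noteq> 0"
  shows "((\<lambda>n. of_real (bessel_I n x) * z powi n) has_sum exp (of_real (x / 2) * (z + 1 / z))) UNIV"
proof -
  define u w where "u = of_real (x / 2) * z" and "w = of_real (x / 2) / z"
  define G where "G = (\<lambda>(n, m). of_real (bessel_term x n m) * z powi n)"
  define T where "T = {(n, m). 0 \<le> int m + n}"
  have uw: "u ^ p / fact p * (w ^ m / fact m) = G (int p - int m, m)" for p m
  proof -
    have "u ^ p * w ^ m = of_real ((x / 2) ^ p * (x / 2) ^ m) * z powi (int p - int m)"
      using z by (simp add: u_def w_def power_mult_distrib power_divide power_int_diff mult_ac)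
    then show ?thesis unfolding G_def prod.case bessel_term_diff by (simp add: field_simps)
  qed
  \<comment> \<open>Reindex by \<open>(p, m) \<mapsto> (p - m, m)\<close>; outside the image \<open>T\<close> the Bessel terms vanish.\<close>
  have "(G has_sum exp u * exp w) T"
  proof (subst has_sum_reindex_bij_witness[symmetric, where S = "UNIV \<times> UNIV"
        and j = "\<lambda>(p, m). (int p - int m, m)" and i = "\<lambda>(n, m). (nat (int m + n), m)"
        and s = "exp u * exp w" and g = "\<lambda>(p, m). u ^ p / fact p * (w ^ m / fact m)"])
    show "((\<lambda>(p, m). u ^ p / fact p * (w ^ m / fact m)) has_sum (exp u * exp w)) (UNIV \<times> UNIV)"
      by (rule exp_product_has_sum)
  qed (auto simp: T_def uw simp del: times_divide_eq_left times_divide_eq_right times_divide_times_eq)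
  also have "?this \<longleftrightarrow> (G has_sum exp u * exp w) (UNIV \<times> UNIV)"
    by (rule has_sum_cong_neutral) (auto simp: T_def G_def bessel_term_eq_0)
  finally have "(G has_sum exp u * exp w) (UNIV \<times> UNIV)" .
  moreover have "((\<lambda>m. G (n, m)) has_sum (of_real (bessel_I n x) * z powi n)) UNIV" for n
    unfolding G_def prod.case
    by (intro has_sum_cmult_left has_sum_of_real bessel_term_has_sum x)
  ultimately have "((\<lambda>n. of_real (bessel_I n x) * z powi n) has_sum (exp u * exp w)) UNIV"
    by (rule has_sum_SigmaD)
  then show ?thesis
    by (simp add: u_def w_def exp_add[symmetric] distrib_left)
qed

text \<open>The first \<open>k\<close> terms of the series of order \<open>-k\<close> vanish; the remaining ones are, after a shift
  by \<open>k\<close>, the terms of the series of order \<open>k\<close>.\<close>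

lemma bessel_I_uminus:
  assumes x: "x > 0" shows "bessel_I (- n) x = bessel_I n x"
proof -
  have *: "bessel_I (- int k) x = bessel_I (int k) x" for k
  proof -
    have "(bessel_term x (- int k) has_sum bessel_I (- int k) x) UNIV \<longleftrightarrow>
        (bessel_term x (- int k) has_sum bessel_I (- int k) x) {k..}"
      by (rule has_sum_cong_neutral) (auto simp: bessel_term_eq_0)
    then have "(bessel_term x (- int k) has_sum bessel_I (- int k) x) {k..}"
      using bessel_term_has_sum[OF x] by blast
    also have "?this \<longleftrightarrow> (bessel_term x (int k) has_sum bessel_I (- int k) x) UNIV"
    proof (rule has_sum_reindex_bij_witness[where i = "\<lambda>m. m + k" and j = "\<lambda>m. m - k"])
      fix m assume "m \<in> {k..}"
      then obtain p where m: "m = p + k" by (metis atLeast_iff le_add_diff_inverse2)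
      have "bessel_term x (int (p + k) - int p) p = bessel_term x (int p - int (p + k)) (p + k)"
        unfolding bessel_term_diff by (simp only: mult.commute)
      then show "bessel_term x (int k) (m - k) = bessel_term x (- int k) m" by (simp add: m)
    qed auto
    finally show ?thesis using bessel_term_has_sum[OF x] has_sum_unique by blast
  qed
  show ?thesis
    using *[of "nat n"] *[of "nat (- n)"] by (cases "n \<ge> 0") auto
qed

section \<open>The spectral measure\<close>

definition sep_weight :: "real \<Rightarrow> int \<Rightarrow> real" where
  "sep_weight a n = exp (- 2 * a\<^sup>2) * bessel_I n (2 * a\<^sup>2)"

lemma sep_weight_nonneg: "a > 0 \<Longrightarrow> 0 \<le> sep_weight a n"
  unfolding sep_weight_def by (intro mult_nonneg_nonneg bessel_I_nonneg) auto

lemma sep_weight_uminus: "a > 0 \<Longrightarrow> sep_weight a (- n) = sep_weight a n"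
  unfolding sep_weight_def by (subst bessel_I_uminus) auto

text \<open>The generating function at \<open>z = cis (2 \<pi> t)\<close>, where \<open>z + 1/z = 2 cos(2 \<pi> t)\<close>.\<close>

lemma sep_phi_has_sum_cis:
  assumes a: "a > 0"
  shows "((\<lambda>n. of_real (sep_weight a n) * cis (2 * pi * of_int n * t)) has_sum of_real (sep_phi a t)) UNIV"
proof -
  have "((\<lambda>n. of_real (bessel_I n (2 * a\<^sup>2)) * cis (2 * pi * t) powi n) has_sum
      exp (of_real (2 * a\<^sup>2 / 2) * (cis (2 * pi * t) + 1 / cis (2 * pi * t)))) UNIV"
    using a by (intro bessel_I_generating_function) auto
  also have "cis (2 * pi * t) + 1 / cis (2 * pi * t) = of_real (2 * cos (2 * pi * t))"
    by (simp add: divide_inverse cis_inverse complex_eq_iff)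
  also have "exp (of_real (2 * a\<^sup>2 / 2) * of_real (2 * cos (2 * pi * t))) =
      (of_real (exp (2 * a\<^sup>2 * cos (2 * pi * t))) :: complex)"
    by (simp add: exp_of_real[symmetric] mult_ac)
  finally have "((\<lambda>n. of_real (exp (- 2 * a\<^sup>2)) * (of_real (bessel_I n (2 * a\<^sup>2)) * cis (2 * pi * t) powi n))
      has_sum of_real (exp (- 2 * a\<^sup>2)) * of_real (exp (2 * a\<^sup>2 * cos (2 * pi * t)))) (UNIV :: int set)"
    by (rule has_sum_cmult_right)
  also have "of_real (exp (- 2 * a\<^sup>2)) * of_real (exp (2 * a\<^sup>2 * cos (2 * pi * t))) =
      (of_real (sep_phi a t) :: complex)"
  proof -
    have "- 2 * a\<^sup>2 + 2 * a\<^sup>2 * cos (2 * (pi * t)) = - 4 * a\<^sup>2 * (sin (pi * t))\<^sup>2"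
      unfolding cos_double_sin by (simp add: algebra_simps)
    then show ?thesis
      unfolding sep_phi_def of_real_mult[symmetric] exp_add[symmetric] by (simp add: mult.assoc)
  qed
  also have "(\<lambda>n. of_real (exp (- 2 * a\<^sup>2)) * (of_real (bessel_I n (2 * a\<^sup>2)) * cis (2 * pi * t) powi n)) =
      (\<lambda>n. of_real (sep_weight a n) * cis (2 * pi * of_int n * t))"
    by (simp add: sep_weight_def cis_power_int mult_ac fun_eq_iff)
  finally show ?thesis .
qed

lemma sep_phi_has_sum_cos:
  assumes a: "a > 0"
  shows "((\<lambda>n. sep_weight a n * cos (2 * pi * of_int n * t)) has_sum sep_phi a t) UNIV"
  using has_sum_Re[OF sep_phi_has_sum_cis[OF a, of t]] by simp

lemma sep_weight_has_sum: "a > 0 \<Longrightarrow> (sep_weight a has_sum 1) UNIV"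
  using sep_phi_has_sum_cos[of a 0] by (simp add: sep_phi_def)

lemma sep_spectral_measure_eq:
  "sep_spectral_measure a = distr (density (count_space UNIV) (\<lambda>n. ennreal (sep_weight a n))) borel
     (\<lambda>n. 2 * pi * real_of_int n)"
  unfolding sep_spectral_measure_def sep_weight_def ..

lemma integrable_sep_weight:
  assumes a: "a > 0" shows "integrable (count_space UNIV) (sep_weight a)"
proof -
  have "Infinite_Sum.abs_summable_on (sep_weight a) UNIV"
    using has_sum_imp_summable[OF sep_weight_has_sum[OF a]] sep_weight_nonneg[OF a] by simp
  then show ?thesis unfolding abs_summable_equivalent abs_summable_on_def .
qed

lemma finite_measure_sep_spectral_measure:
  assumes a: "a > 0" shows "finite_measure (sep_spectral_measure a)"
proof -
  have "(\<integral>\<^sup>+ n. ennreal (sep_weight a n) \<partial>count_space UNIV) = ennreal (\<integral> n. sep_weight a n \<partial>count_space UNIV)"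
    using integrable_sep_weight[OF a] sep_weight_nonneg[OF a] by (intro nn_integral_eq_integral) auto
  then have "finite_measure (density (count_space UNIV) (\<lambda>n. ennreal (sep_weight a n)))"
    by (intro finite_measureI) (simp add: emeasure_density)
  then show ?thesis
    unfolding sep_spectral_measure_eq by (rule finite_measure.finite_measure_distr) simp
qed

lemma distr_uminus_sep_spectral_measure:
  assumes a: "a > 0"
  shows "distr (sep_spectral_measure a) borel uminus = sep_spectral_measure a"
proof (rule measure_eqI)
  fix A assume "A \<in> sets (distr (sep_spectral_measure a) borel uminus)"
  then have A[measurable]: "A \<in> sets borel" by simp
  define F where "F n = ennreal (sep_weight a n) * indicator A (2 * pi * real_of_int n)" for n :: int
  have *: "emeasure (distr (sep_spectral_measure a) borel uminus) A = (\<integral>\<^sup>+ n. F (- n) \<partial>count_space UNIV)"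
    unfolding sep_spectral_measure_eq F_def sep_weight_uminus[OF a]
    by (subst distr_distr)
      (auto simp: emeasure_distr emeasure_density indicator_def intro!: nn_integral_cong)
  also have "\<dots> = (\<integral>\<^sup>+ n. F n \<partial>count_space UNIV)"
    by (rule nn_integral_bij_count_space) (simp add: bij_uminus)
  also have "\<dots> = emeasure (sep_spectral_measure a) A"
    unfolding sep_spectral_measure_eq F_def
    by (auto simp: emeasure_distr emeasure_density indicator_def intro!: nn_integral_cong)
  finally show "emeasure (distr (sep_spectral_measure a) borel uminus) A = emeasure (sep_spectral_measure a) A" .
qed (simp add: sep_spectral_measure_def)

text \<open>The integral over the spectral measure is the Fourier series at \<open>- t\<close>, and the SEP function is
  even.\<close>

lemma sep_phi_spectral_representation:
  assumes a: "a > 0"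
  shows "complex_of_real (sep_phi a t) =
    (\<integral>s. exp (- \<i> * complex_of_real t * complex_of_real s) \<partial>sep_spectral_measure a)"
proof -
  define g where "g n = of_real (sep_weight a n) * cis (2 * pi * of_int n * (- t))" for n
  have e: "exp (- \<i> * complex_of_real t * complex_of_real (2 * pi * real_of_int n)) = cis (2 * pi * of_int n * (- t))" for n
    unfolding cis_conv_exp by (simp add: mult_ac)
  have "(\<integral>s. exp (- \<i> * complex_of_real t * complex_of_real s) \<partial>sep_spectral_measure a) =
      (\<integral>n. g n \<partial>count_space UNIV)"
    unfolding sep_spectral_measure_eq
    by (subst integral_distr, simp, simp, subst integral_density)
      (simp_all only: e g_def[abs_def] scaleR_conv_of_real sep_weight_nonneg[OF a] borel_measurable_count_space always_eventually simp_thms)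
  also have "\<dots> = infsum g UNIV"
  proof -
    have "Infinite_Sum.abs_summable_on g UNIV"
      using has_sum_imp_summable[OF sep_weight_has_sum[OF a]] sep_weight_nonneg[OF a]
      by (simp add: g_def norm_mult)
    then show ?thesis
      unfolding infsetsum_def[symmetric] by (intro infsetsum_infsum) (simp add: abs_summable_equivalent)
  qed
  also have "\<dots> = of_real (sep_phi a (- t))"
    unfolding g_def by (rule infsumI[OF sep_phi_has_sum_cis[OF a]])
  finally show ?thesis by (simp add: sep_phi_def)
qed

section \<open>Integrable functions with vanishing Fourier coefficients\<close>

abbreviation unit_lebesgue :: "real measure" where
  "unit_lebesgue \<equiv> lebesgue_on {0..1}"

lemma continuous_on_real_polynomial_cis:
  assumes "real_polynomial_function p"
  shows "continuous_on S (\<lambda>t. p (cis (2 * pi * t)))"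
  by (intro continuous_on_compose2[OF continuous_on_polymonial_function[of p UNIV]] continuous_intros)
    (use assms in \<open>auto simp: real_polynomial_function_eq\<close>)

lemma integrable_times_continuous_unit:
  fixes f :: "real \<Rightarrow> real" and g :: "real \<Rightarrow> complex"
  assumes f: "integrable unit_lebesgue f" and g: "continuous_on {0..1} g"
  shows "integrable unit_lebesgue (\<lambda>t. of_real (f t) * g t)"
proof -
  obtain B where B: "\<And>t. t \<in> {0..1} \<Longrightarrow> norm (g t) \<le> B"
    using compact_imp_bounded[OF compact_continuous_image[OF g compact_Icc]]
    unfolding bounded_iff by (metis imageI)
  have [measurable]: "g \<in> borel_measurable unit_lebesgue"
    by (rule continuous_imp_measurable_on_sets_lebesgue[OF g]) simp
  have [measurable]: "f \<in> borel_measurable unit_lebesgue" using f by auto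
  show ?thesis
  proof (rule Bochner_Integration.integrable_bound)
    show "integrable unit_lebesgue (\<lambda>t. B * f t)" using f by simp
    show "AE t in unit_lebesgue. norm (of_real (f t) * g t) \<le> norm (B * f t)"
    proof (rule AE_I2)
      fix t assume "t \<in> space unit_lebesgue"
      then have "norm (g t) \<le> \<bar>B\<bar>" using B[of t] by simp
      then have "norm (g t) * \<bar>f t\<bar> \<le> \<bar>B\<bar> * \<bar>f t\<bar>" by (rule mult_right_mono) simp
      then show "norm (of_real (f t) * g t) \<le> norm (B * f t)"
        by (simp add: norm_mult abs_mult mult.commute)
    qed
  qed measurable
qed

text \<open>The vanishing of all Fourier coefficients of \<open>f h\<close> is stable under multiplication of \<open>h\<close> by a
  polynomial in the coordinates of the circle: a linear factor shifts the frequencies by \<open>\<plusminus>1\<close>. Stating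
  this for all \<open>h\<close> at once lets the induction over polynomials pass through products.\<close>

lemma cis_moments_real_polynomial:
  fixes f :: "real \<Rightarrow> real" and p :: "complex \<Rightarrow> real" and h :: "real \<Rightarrow> complex"
  assumes p: "real_polynomial_function p"
    and f: "integrable unit_lebesgue f"
    and h: "continuous_on {0..1} h"
    and h0: "\<And>n::int. (\<integral>t. of_real (f t) * (h t * cis (2 * pi * of_int n * t)) \<partial>unit_lebesgue) = 0"
  shows "(\<integral>t. of_real (f t) * (of_real (p (cis (2 * pi * t))) * h t * cis (2 * pi * of_int n * t)) \<partial>unit_lebesgue) = 0"
  using p h h0
proof (induction p arbitrary: h n rule: real_polynomial_function.induct)
  case (linear L)
  interpret L: bounded_linear L by fact
  define \<alpha> \<beta> where "\<alpha> = (of_real (L 1) - \<i> * of_real (L \<i>)) / 2"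
    and "\<beta> = (of_real (L 1) + \<i> * of_real (L \<i>)) / 2"
  have L: "of_real (L (cis x)) = \<alpha> * cis x + \<beta> * cis (- x)" for x
  proof -
    have "cis x = cos x *\<^sub>R 1 + sin x *\<^sub>R \<i>" by (simp add: complex_eq_iff)
    then have "L (cis x) = cos x * L 1 + sin x * L \<i>"
      by (simp only: L.add L.scaleR real_scaleR_def)
    then show ?thesis by (simp add: \<alpha>_def \<beta>_def complex_eq_iff field_simps)
  qed
  have e: "of_real (f t) * (of_real (L (cis (2 * pi * t))) * h t * cis (2 * pi * of_int n * t)) =
     \<alpha> * (of_real (f t) * (h t * cis (2 * pi * of_int (n + 1) * t))) +
     \<beta> * (of_real (f t) * (h t * cis (2 * pi * of_int (n - 1) * t)))" for t
  proof -
    have c: "cis (2 * pi * of_int (n + 1) * t) = cis (2 * pi * t) * cis (2 * pi * of_int n * t)"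
        "cis (2 * pi * of_int (n - 1) * t) = cis (- (2 * pi * t)) * cis (2 * pi * of_int n * t)"
      by (simp_all add: cis_mult algebra_simps)
    show ?thesis unfolding L c by (simp add: algebra_simps)
  qed
  have i: "integrable unit_lebesgue (\<lambda>t. of_real (f t) * (h t * cis (2 * pi * of_int k * t)))" for k :: int
    by (intro integrable_times_continuous_unit f continuous_intros linear)
  show ?case unfolding e
    using linear(3)[of "n + 1"] linear(3)[of "n - 1"] i[of "n + 1"] i[of "n - 1"] by simp
next
  case (const c)
  have e: "of_real (f t) * (of_real c * h t * cis (2 * pi * of_int n * t)) =
      of_real c * (of_real (f t) * (h t * cis (2 * pi * of_int n * t)))" for t
    by (simp only: mult_ac)
  show ?case unfolding e using const by simp
next
  case (add p q)
  have c: "continuous_on {0..1} (\<lambda>t. of_real (r (cis (2 * pi * t))) :: complex)"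
    if "real_polynomial_function r" for r
    by (intro continuous_on_of_real continuous_on_real_polynomial_cis that)
  have i: "integrable unit_lebesgue (\<lambda>t. of_real (f t) *
      (of_real (r (cis (2 * pi * t))) * h t * cis (2 * pi * of_int n * t)))"
    if "real_polynomial_function r" for r
    by (intro integrable_times_continuous_unit f continuous_intros add c that)
  show ?case
    using add.IH[OF add.prems, of n] i[OF add.hyps(1)] i[OF add.hyps(2)]
    by (simp add: distrib_left distrib_right)
next
  case (mult p q)
  have c: "continuous_on {0..1} (\<lambda>t. of_real (q (cis (2 * pi * t))) :: complex)"
    by (intro continuous_on_of_real continuous_on_real_polynomial_cis mult.hyps)
  show ?case
    using mult.IH(1)[of "\<lambda>t. of_real (q (cis (2 * pi * t))) * h t" n] mult.IH(2)[OF mult.prems]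
      c mult.prems(1)
    by (simp add: continuous_on_mult mult_ac)
qed

text \<open>A continuous function on the interval with equal end values factors through the circle; this
  makes the compact set on which Stone--Weierstrass is applied one on which the trigonometric
  polynomials separate points.\<close>

lemma continuous_on_circle_of_loop:
  fixes g :: "real \<Rightarrow> real"
  assumes g: "continuous_on {0..1} g" and eq: "g 0 = g 1"
  obtains G :: "complex \<Rightarrow> real" where "continuous_on (sphere 0 1) G"
    and "\<And>t. t \<in> {0..1} \<Longrightarrow> G (cis (2 * pi * t)) = g t"
proof
  have "homotopic_loops UNIV g g"
    using g eq by (simp add: homotopic_loops_refl path_def pathstart_def pathfinish_def)
  then show "continuous_on (sphere 0 1) (g \<circ> (\<lambda>z. Arg2pi z / (2 * pi)))"
    using homotopic_with_imp_continuous[OF homotopic_loops_imp_homotopic_circlemaps] by blast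
  fix t :: real assume t: "t \<in> {0..1}"
  show "(g \<circ> (\<lambda>z. Arg2pi z / (2 * pi))) (cis (2 * pi * t)) = g t"
  proof (cases "t = 1")
    case True
    then show ?thesis using eq Arg2pi_of_real[of 1] by simp
  next
    case False
    then have "2 * pi * t < 2 * pi" using t by simp
    then have "Arg2pi (cis (2 * pi * t)) = 2 * pi * t"
      using t unfolding cis_conv_exp by (subst Arg2pi_exp) simp_all
    then show ?thesis by simp
  qed
qed

lemma integral_times_loop_eq_0:
  fixes f g :: "real \<Rightarrow> real"
  assumes f: "integrable unit_lebesgue f"
    and f0: "\<And>n::int. (\<integral>t. of_real (f t) * cis (2 * pi * of_int n * t) \<partial>unit_lebesgue) = 0"
    and g: "continuous_on {0..1} g" and eq: "g 0 = g 1"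
  shows "(\<integral>t. f t * g t \<partial>unit_lebesgue) = 0"
proof -
  define J where "J = (\<integral>t. \<bar>f t\<bar> \<partial>unit_lebesgue)"
  have J: "0 \<le> J" unfolding J_def by simp
  obtain G where G: "continuous_on (sphere 0 1) G"
      "\<And>t. t \<in> {0..1} \<Longrightarrow> G (cis (2 * pi * t)) = g t"
    using continuous_on_circle_of_loop[OF g eq] by blast
  have i: "integrable unit_lebesgue (\<lambda>t. f t * u t)" if "continuous_on {0..1} u" for u :: "real \<Rightarrow> real"
    using integrable_Re[OF integrable_times_continuous_unit[OF f continuous_on_of_real[OF that]]] by simp
  have "\<bar>\<integral>t. f t * g t \<partial>unit_lebesgue\<bar> \<le> e" if e: "e > 0" for e
  proof -
    \<comment> \<open>The denominator \<open>J + 1\<close> avoids a case split on \<open>J = 0\<close>.\<close>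
    define d where "d = e / (J + 1)"
    have d: "d > 0" "d * J \<le> e" using e J by (auto simp: d_def field_simps)
    obtain p where p: "real_polynomial_function p"
        "\<And>z. z \<in> sphere 0 1 \<Longrightarrow> \<bar>G z - p z\<bar> < d"
      using Stone_Weierstrass_real_polynomial_function[OF _ G(1) d(1)] by auto
    define q where "q t = p (cis (2 * pi * t))" for t
    have q: "continuous_on {0..1} q" unfolding q_def
      by (rule continuous_on_real_polynomial_cis[OF p(1)])
    have "(\<integral>t. complex_of_real (f t * q t) \<partial>unit_lebesgue) = 0"
      using cis_moments_real_polynomial[OF p(1) f, of "\<lambda>_. 1" 0] f0 by (simp add: q_def)
    then have q0: "(\<integral>t. f t * q t \<partial>unit_lebesgue) = 0"
      by (simp only: integral_complex_of_real of_real_eq_0_iff)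
    have "\<bar>\<integral>t. f t * g t \<partial>unit_lebesgue\<bar> = \<bar>\<integral>t. f t * g t - f t * q t \<partial>unit_lebesgue\<bar>"
      using i[OF g] i[OF q] q0 by simp
    also have "\<dots> \<le> (\<integral>t. \<bar>f t * g t - f t * q t\<bar> \<partial>unit_lebesgue)"
      by (rule integral_abs_bound)
    also have "\<dots> \<le> (\<integral>t. d * \<bar>f t\<bar> \<partial>unit_lebesgue)"
    proof (rule integral_mono)
      show "integrable unit_lebesgue (\<lambda>t. \<bar>f t * g t - f t * q t\<bar>)"
        using i[OF g] i[OF q] by simp
      show "integrable unit_lebesgue (\<lambda>t. d * \<bar>f t\<bar>)" using f by simp
      fix t assume "t \<in> space unit_lebesgue"
      then have t: "t \<in> {0..1}" by simp
      have "\<bar>g t - q t\<bar> \<le> d"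
        using p(2)[of "cis (2 * pi * t)"] G(2)[OF t] by (simp add: q_def)
      then have "\<bar>f t\<bar> * \<bar>g t - q t\<bar> \<le> \<bar>f t\<bar> * d" by (rule mult_left_mono) simp
      then show "\<bar>f t * g t - f t * q t\<bar> \<le> d * \<bar>f t\<bar>"
        by (simp only: right_diff_distrib[symmetric] abs_mult mult.commute)
    qed
    also have "\<dots> = d * J" by (simp add: J_def)
    finally show ?thesis using d by linarith
  qed
  then have "\<bar>\<integral>t. f t * g t \<partial>unit_lebesgue\<bar> \<le> 0" by (rule field_le_epsilon) simp
  then show ?thesis by simp
qed

text \<open>The sign of \<open>f\<close> is approximated almost everywhere by continuous functions, clamped to
  \<open>[-1, 1]\<close> for domination and cut off at the ends of the interval so that they close up to loops.\<close>

lemma AE_eq_0_of_cis_moments: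
  fixes f :: "real \<Rightarrow> real"
  assumes f: "integrable unit_lebesgue f"
    and f0: "\<And>n::int. (\<integral>t. of_real (f t) * cis (2 * pi * of_int n * t) \<partial>unit_lebesgue) = 0"
  shows "AE t in unit_lebesgue. f t = 0"
proof -
  have [measurable]: "f \<in> borel_measurable unit_lebesgue" using f by auto
  have "(\<lambda>t. sgn (f t)) measurable_on {0..1}"
    by (subst measurable_on_iff_borel_measurable) auto
  then obtain N g where N: "negligible N" and g: "\<And>n. continuous_on UNIV (g n)"
    and lim: "\<And>t. t \<notin> N \<Longrightarrow> (\<lambda>n. g n t) \<longlonglongrightarrow> (if t \<in> {0..1} then sgn (f t) else 0)"
    unfolding measurable_on_def by blast
  \<comment> \<open>The factor \<open>min 1 (n t (1 - t))\<close> vanishes at \<open>0\<close> and \<open>1\<close> and is eventually \<open>1\<close> in between.\<close>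
  define k where "k n t = max (-1) (min 1 (g n t)) * min 1 (real n * (t * (1 - t)))" for n :: nat and t :: real
  have k: "continuous_on {0..1} (k n)" for n
    unfolding k_def by (intro continuous_intros continuous_on_subset[OF g]) auto
  have k0: "(\<integral>t. f t * k n t \<partial>unit_lebesgue) = 0" for n
    by (rule integral_times_loop_eq_0[OF f f0 k]) (simp add: k_def)
  have kb: "\<bar>k n t\<bar> \<le> 1" if "t \<in> {0..1}" for n t
  proof -
    have "0 \<le> real n * (t * (1 - t))" using that by simp
    then have "\<bar>max (-1) (min 1 (g n t))\<bar> * \<bar>min 1 (real n * (t * (1 - t)))\<bar> \<le> 1 * 1"
      by (intro mult_mono) auto
    then show ?thesis by (simp add: k_def abs_mult)
  qed
  have klim: "(\<lambda>n. k n t) \<longlonglongrightarrow> sgn (f t)" if t: "t \<in> {0..1} - (N \<union> {0, 1})" for t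
  proof -
    have "(\<lambda>n. g n t) \<longlonglongrightarrow> sgn (f t)" using lim[of t] t by auto
    then have "(\<lambda>n. max (-1) (min 1 (g n t))) \<longlonglongrightarrow> max (-1) (min 1 (sgn (f t)))"
      by (intro tendsto_intros)
    also have "max (-1) (min 1 (sgn (f t))) = sgn (f t)" by (simp add: sgn_if)
    finally have 1: "(\<lambda>n. max (-1) (min 1 (g n t))) \<longlonglongrightarrow> sgn (f t)" .
    have pos: "0 < t * (1 - t)" using t by auto
    obtain m where m: "1 < real m * (t * (1 - t))" using reals_Archimedean3[OF pos] by blast
    have "min 1 (real n * (t * (1 - t))) = 1" if "n \<ge> m" for n
    proof -
      have "real m * (t * (1 - t)) \<le> real n * (t * (1 - t))"
        using that pos by (intro mult_right_mono) auto
      then show ?thesis using m by simp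
    qed
    then have "(\<lambda>n. min 1 (real n * (t * (1 - t)))) \<longlonglongrightarrow> 1"
      by (intro tendsto_eventually) (auto simp: eventually_sequentially)
    from tendsto_mult[OF 1 this] show ?thesis by (simp add: k_def)
  qed
  have "(\<lambda>n. \<integral>t. f t * k n t \<partial>unit_lebesgue) \<longlonglongrightarrow> (\<integral>t. \<bar>f t\<bar> \<partial>unit_lebesgue)"
  proof (rule integral_dominated_convergence[where w = "\<lambda>t. \<bar>f t\<bar>"])
    have [measurable]: "k n \<in> borel_measurable unit_lebesgue" for n
      by (rule continuous_imp_measurable_on_sets_lebesgue[OF k]) simp
    show "(\<lambda>t. f t * k n t) \<in> borel_measurable unit_lebesgue" for n by measurable
    show "AE t in unit_lebesgue. norm (f t * k n t) \<le> \<bar>f t\<bar>" for n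
      using kb by (intro AE_I2) (simp add: abs_mult mult_left_le)
    have "negligible (N \<union> {0, 1})" using N by (intro negligible_Un) auto
    then have "AE t in lebesgue. t \<notin> N \<union> {0, 1}"
      unfolding negligible_iff_null_sets by (rule AE_not_in)
    then have "AE t in unit_lebesgue. t \<notin> N \<union> {0, 1}"
      by (subst AE_restrict_space_iff) auto
    then show "AE t in unit_lebesgue. (\<lambda>n. f t * k n t) \<longlonglongrightarrow> \<bar>f t\<bar>"
    proof (rule AE_mp, intro AE_I2 impI)
      fix t assume "t \<in> space unit_lebesgue" "t \<notin> N \<union> {0, 1}"
      then have "(\<lambda>n. f t * k n t) \<longlonglongrightarrow> f t * sgn (f t)" by (intro tendsto_mult klim tendsto_const) auto
      then show "(\<lambda>n. f t * k n t) \<longlonglongrightarrow> \<bar>f t\<bar>" by (simp add: abs_sgn)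
    qed
  qed (use f in auto)
  then have "(\<integral>t. \<bar>f t\<bar> \<partial>unit_lebesgue) = 0"
    unfolding k0 by (simp add: LIMSEQ_const_iff)
  then show ?thesis
    using integral_nonneg_eq_0_iff_AE[of unit_lebesgue "\<lambda>t. \<bar>f t\<bar>"] f by simp
qed

section \<open>The real Fourier basis\<close>

definition fourier_basis :: "nat \<Rightarrow> real \<Rightarrow> real" where
  "fourier_basis k t =
     (if k = 1 then 1
      else if even k then sqrt 2 * cos (2 * pi * real (k div 2) * t)
      else sqrt 2 * sin (2 * pi * real (k div 2) * t))"

lemma fourier_basis_simps:
  "fourier_basis (Suc 0) t = 1"
  "fourier_basis (2 * j) t = sqrt 2 * cos (2 * pi * real j * t)"
  "j \<ge> 1 \<Longrightarrow> fourier_basis (Suc (2 * j)) t = sqrt 2 * sin (2 * pi * real j * t)"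
  by (auto simp: fourier_basis_def)

lemma fourier_index_cases:
  assumes "k \<ge> 1"
  obtains "k = Suc 0" | j where "j \<ge> 1" "k = 2 * j" | j where "j \<ge> 1" "k = Suc (2 * j)"
  using assms by (cases "even k") (auto elim!: evenE oddE, metis One_nat_def Suc_leI neq0_conv mult_0_right)

lemma continuous_fourier_basis: "continuous_on S (fourier_basis k)"
  unfolding fourier_basis_def[abs_def]
  by (cases "k = 1"; cases "even k") (auto intro!: continuous_intros)

lemma abs_fourier_basis_le: "\<bar>fourier_basis k t\<bar> \<le> sqrt 2"
  unfolding fourier_basis_def by (auto simp: abs_mult mult_left_le)

lemma integral_cos_unit:
  "(\<integral>t. cos (2 * pi * real_of_int n * t) \<partial>unit_lebesgue) = (if n = 0 then 1 else 0)"
proof (cases "n = 0")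
  case False
  then have c: "2 * pi * real_of_int n \<noteq> 0" by simp
  have "((\<lambda>t. cos (2 * pi * real_of_int n * t)) has_integral
      sin (2 * pi * real_of_int n * 1) / (2 * pi * real_of_int n) -
      sin (2 * pi * real_of_int n * 0) / (2 * pi * real_of_int n)) {0..1}"
    by (rule fundamental_theorem_of_calculus)
      (use c in \<open>auto intro!: derivative_eq_intros simp flip: has_real_derivative_iff_has_vector_derivative\<close>)
  moreover have "sin (2 * pi * real_of_int n) = 0" 
    using sin_integer_2pi[of "real_of_int n"] by simp
  ultimately have "integral {0..1} (\<lambda>t. cos (2 * pi * real_of_int n * t)) = 0"
    by (intro integral_unique) simp
  then show ?thesis using False
    by (subst lebesgue_integral_eq_integral) (auto intro!: continuous_imp_integrable_real continuous_intros)
qed (simp add: measure_restrict_space)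

lemma integral_sin_unit:
  "(\<integral>t. sin (2 * pi * real_of_int n * t) \<partial>unit_lebesgue) = 0"
proof (cases "n = 0")
  case False
  then have c: "2 * pi * real_of_int n \<noteq> 0" by simp
  have "((\<lambda>t. sin (2 * pi * real_of_int n * t)) has_integral
      - cos (2 * pi * real_of_int n * 1) / (2 * pi * real_of_int n) -
      - cos (2 * pi * real_of_int n * 0) / (2 * pi * real_of_int n)) {0..1}"
    by (rule fundamental_theorem_of_calculus)
      (use c in \<open>auto intro!: derivative_eq_intros simp flip: has_real_derivative_iff_has_vector_derivative\<close>)
  moreover have "cos (2 * pi * real_of_int n) = 1"
    using cos_integer_2pi[of "real_of_int n"] by simp
  ultimately have "integral {0..1} (\<lambda>t. sin (2 * pi * real_of_int n * t)) = 0"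
    by (intro integral_unique) simp
  then show ?thesis using False
    by (subst lebesgue_integral_eq_integral) (auto intro!: continuous_imp_integrable_real continuous_intros)
qed simp

lemma integral_trig_products_unit:
  "(\<integral>t. cos (2 * pi * real i * t) * cos (2 * pi * real j * t) \<partial>unit_lebesgue) =
     ((if i = j then 1 else 0) + (if i = 0 \<and> j = 0 then 1 else 0)) / 2" (is ?cc)
  "(\<integral>t. sin (2 * pi * real i * t) * sin (2 * pi * real j * t) \<partial>unit_lebesgue) =
     ((if i = j then 1 else 0) - (if i = 0 \<and> j = 0 then 1 else 0)) / 2" (is ?ss)
  "(\<integral>t. sin (2 * pi * real i * t) * cos (2 * pi * real j * t) \<partial>unit_lebesgue) = 0" (is ?sc)
proof -
  define m p where "m = int i - int j" and "p = int i + int j"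
  have m: "2 * pi * real i * t - 2 * pi * real j * t = 2 * pi * real_of_int m * t"
    and p: "2 * pi * real i * t + 2 * pi * real j * t = 2 * pi * real_of_int p * t" for t
    by (simp_all add: m_def p_def algebra_simps)
  have ic: "integrable unit_lebesgue (\<lambda>t. cos (2 * pi * real_of_int n * t))"
    and si: "integrable unit_lebesgue (\<lambda>t. sin (2 * pi * real_of_int n * t))" for n
    by (intro continuous_imp_integrable_real continuous_intros)+
  show ?cc unfolding cos_times_cos m p
    using ic[of m] ic[of p] by (simp add: integral_cos_unit) (auto simp: m_def p_def)
  show ?ss unfolding sin_times_sin m p
    using ic[of m] ic[of p] by (simp add: integral_cos_unit) (auto simp: m_def p_def)
  show ?sc unfolding sin_times_cos m p
    using si[of m] si[of p] by (simp add: integral_sin_unit)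
qed

lemma fourier_basis_orthonormal:
  assumes "j \<ge> 1" "k \<ge> 1"
  shows "(\<integral>t. fourier_basis j t * fourier_basis k t \<partial>unit_lebesgue) = (if j = k then 1 else 0)"
proof -
  note I = integral_trig_products_unit
  have sc: "(\<integral>t. cos (2 * pi * real j * t) * sin (2 * pi * real i * t) \<partial>unit_lebesgue) = 0" for i j
    using I(3)[of i j] by (simp add: mult.commute)
  have one: "(\<integral>t. cos (2 * pi * real j * t) \<partial>unit_lebesgue) = (if j = 0 then 1 else 0)"
     "(\<integral>t. sin (2 * pi * real j * t) \<partial>unit_lebesgue) = 0" for j
    using integral_cos_unit[of "int j"] integral_sin_unit[of "int j"] by simp_all
  have r: "sqrt 2 * x * (sqrt 2 * y) = 2 * (x * y)" for x y :: real by simp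
  have ne: "2 * i \<noteq> Suc (2 * j)" "Suc (2 * i) \<noteq> 2 * j" for i j :: nat by presburger+
  show ?thesis
    by (cases rule: fourier_index_cases[OF assms(1)]; cases rule: fourier_index_cases[OF assms(2)];
        simp only: fourier_basis_simps r mult_1_left mult_1_right integral_mult_right_zero I sc one)
      (use ne in \<open>auto simp: measure_restrict_space\<close>)
qed

lemma square_integrable_unit_imp_integrable:
  assumes "square_integrable_unit f" shows "integrable unit_lebesgue f"
proof (rule Bochner_Integration.integrable_bound)
  show "integrable unit_lebesgue (\<lambda>t. 1 + (f t)\<^sup>2)"
    using assms unfolding square_integrable_unit_def
    by (intro Bochner_Integration.integrable_add) (auto intro!: continuous_imp_integrable_real)
  show "f \<in> borel_measurable unit_lebesgue" using assms unfolding square_integrable_unit_def by blast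
  have "\<bar>x\<bar> \<le> 1 + x\<^sup>2" for x :: real
    using sum_power2_ge_zero[of "\<bar>x\<bar> - 1" 0] abs_ge_zero[of x] by (simp add: power2_diff)
  then show "AE t in unit_lebesgue. norm (f t) \<le> norm (1 + (f t)\<^sup>2)"
    by (intro AE_I2) (simp add: abs_of_nonneg)
qed

text \<open>Up to constants and signs, the Fourier coefficient of \<open>f\<close> at frequency \<open>n\<close> is made of the
  inner products of \<open>f\<close> with the cosine and the sine of frequency \<open>\<bar>n\<bar>\<close>.\<close>

lemma fourier_basis_complete:
  assumes f: "integrable unit_lebesgue f"
    and f0: "\<And>k. k \<ge> 1 \<Longrightarrow> (\<integral>t. f t * fourier_basis k t \<partial>unit_lebesgue) = 0"
  shows "AE t in unit_lebesgue. f t = 0"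
proof (rule AE_eq_0_of_cis_moments[OF f])
  fix n :: int
  define j where "j = nat \<bar>n\<bar>"
  have r: "f t * (sqrt 2 * x) = sqrt 2 * (f t * x)" for t x by simp
  have "(\<integral>t. f t * cos (2 * pi * real j * t) \<partial>unit_lebesgue) = 0"
  proof (cases "j = 0")
    case True then show ?thesis using f0[of 1] by (simp add: fourier_basis_simps)
  next
    case False then show ?thesis using f0[of "2 * j"] by (simp add: fourier_basis_simps r)
  qed
  moreover have "cos (2 * pi * real j * t) = cos (2 * pi * real_of_int n * t)" for t
    by (simp add: j_def abs_if)
  ultimately have c: "(\<integral>t. f t * cos (2 * pi * real_of_int n * t) \<partial>unit_lebesgue) = 0" by simp
  have "(\<integral>t. f t * sin (2 * pi * real j * t) \<partial>unit_lebesgue) = 0"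
  proof (cases "j = 0")
    case False then show ?thesis using f0[of "Suc (2 * j)"] by (simp add: fourier_basis_simps r)
  qed simp
  moreover have "f t * sin (2 * pi * real j * t) = of_int (sgn n) * (f t * sin (2 * pi * real_of_int n * t))" for t
    by (simp add: j_def abs_if sgn_if)
  ultimately have "of_int (sgn n) * (\<integral>t. f t * sin (2 * pi * real_of_int n * t) \<partial>unit_lebesgue) = 0"
    by simp
  then have s: "(\<integral>t. f t * sin (2 * pi * real_of_int n * t) \<partial>unit_lebesgue) = 0"
    by (cases "n = 0") (auto simp: sgn_if split: if_splits)
  have i: "integrable unit_lebesgue (\<lambda>t. complex_of_real (f t) * cis (2 * pi * real_of_int n * t))"
    by (intro integrable_times_continuous_unit f continuous_intros)
  show "(\<integral>t. complex_of_real (f t) * cis (2 * pi * real_of_int n * t) \<partial>unit_lebesgue) = 0"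
    using integral_Re[OF i] integral_Im[OF i] c s by (simp add: complex_eq_iff)
qed

theorem fourier_basis_orthonormal_basis: "orthonormal_basis_unit fourier_basis"
  unfolding orthonormal_basis_unit_def
proof (intro conjI allI impI)
  fix k :: nat
  show "square_integrable_unit (fourier_basis k)"
    unfolding square_integrable_unit_def
    by (auto intro!: continuous_imp_measurable_on_sets_lebesgue continuous_imp_integrable_real
        continuous_fourier_basis continuous_intros)
qed (auto simp: fourier_basis_orthonormal intro: fourier_basis_complete square_integrable_unit_imp_integrable)

section \<open>The Karhunen--Loeve expansion\<close>

text \<open>The terms of the expansion, multiplied by the \<open>m\<close>-th function, are dominated by the summable
  constants \<open>\<bar>v\<^sub>i\<bar> B\<^sup>3\<close>. Integrating term by term, orthonormality leaves only the \<open>m\<close>-th term.\<close>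

lemma eigenpair_unit_of_expansion:
  assumes orth: "\<And>i j. i \<ge> 1 \<Longrightarrow> j \<ge> 1 \<Longrightarrow> (\<integral>t. \<psi> i t * \<psi> j t \<partial>unit_lebesgue) = (if i = j then 1 else 0)"
    and cont: "\<And>i. continuous_on {0..1} (\<psi> i)"
    and bound: "\<And>i t. \<bar>\<psi> i t\<bar> \<le> B"
    and v: "summable (\<lambda>i. \<bar>v (Suc i)\<bar>)"
    and K: "\<And>t s. t \<in> {0..1} \<Longrightarrow> s \<in> {0..1} \<Longrightarrow> (\<lambda>i. v (Suc i) * \<psi> (Suc i) t * \<psi> (Suc i) s) sums K t s"
    and m: "m \<ge> 1"
  shows "eigenpair_unit K (v m) (\<psi> m)"
  unfolding eigenpair_unit_def
proof
  fix t :: real assume t: "t \<in> {0..1}"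
  define F where "F i s = v (Suc i) * \<psi> (Suc i) t * (\<psi> (Suc i) s * \<psi> m s)" for i s
  have B: "0 \<le> B" using bound[of 0 0] by linarith
  have Fint: "integrable unit_lebesgue (F i)" for i
    unfolding F_def by (intro continuous_imp_integrable_real continuous_intros cont)
  have Fb: "\<bar>F i s\<bar> \<le> \<bar>v (Suc i)\<bar> * B ^ 3" for i s
  proof -
    have "\<bar>\<psi> (Suc i) t\<bar> * (\<bar>\<psi> (Suc i) s\<bar> * \<bar>\<psi> m s\<bar>) \<le> B * (B * B)"
      by (intro mult_mono bound mult_nonneg_nonneg B abs_ge_zero)
    then have "\<bar>v (Suc i)\<bar> * (\<bar>\<psi> (Suc i) t\<bar> * (\<bar>\<psi> (Suc i) s\<bar> * \<bar>\<psi> m s\<bar>)) \<le> \<bar>v (Suc i)\<bar> * (B * (B * B))"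
      by (rule mult_left_mono) simp
    then show ?thesis by (simp add: F_def abs_mult mult.assoc power3_eq_cube)
  qed
  have vB: "summable (\<lambda>i. \<bar>v (Suc i)\<bar> * B ^ 3)" by (rule summable_mult2[OF v])
  have s1: "AE s in unit_lebesgue. summable (\<lambda>i. norm (F i s))"
    by (intro AE_I2 summable_comparison_test'[OF vB]) (simp add: Fb)
  have s2: "summable (\<lambda>i. \<integral>s. norm (F i s) \<partial>unit_lebesgue)"
  proof (rule summable_comparison_test'[OF vB])
    fix i
    have "(\<integral>s. norm (F i s) \<partial>unit_lebesgue) \<le> (\<integral>s. \<bar>v (Suc i)\<bar> * B ^ 3 \<partial>unit_lebesgue)"
      using Fint by (intro integral_mono) (auto simp: Fb intro!: continuous_imp_integrable_real)
    then show "norm (\<integral>s. norm (F i s) \<partial>unit_lebesgue) \<le> \<bar>v (Suc i)\<bar> * B ^ 3"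
      by (simp add: measure_restrict_space)
  qed
  have FK: "(\<Sum>i. F i s) = K t s * \<psi> m s" if "s \<in> space unit_lebesgue" for s
    using sums_unique[OF sums_mult2[OF K[OF t, of s], of "\<psi> m s"]] that
    by (simp add: F_def[abs_def] mult.assoc)
  have "(\<lambda>i. \<integral>s. F i s \<partial>unit_lebesgue) sums (\<integral>s. (\<Sum>i. F i s) \<partial>unit_lebesgue)"
    by (rule sums_integral[OF Fint s1 s2])
  moreover have "(\<integral>s. F i s \<partial>unit_lebesgue) = (if i = m - 1 then v m * \<psi> m t else 0)" for i
    unfolding F_def using orth[of "Suc i" m] m by auto
  ultimately have "(\<integral>s. (\<Sum>i. F i s) \<partial>unit_lebesgue) = v m * \<psi> m t"
    using sums_single[of "m - 1" "\<lambda>_. v m * \<psi> m t"] sums_unique2 by auto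
  then have "has_bochner_integral unit_lebesgue (\<lambda>s. \<Sum>i. F i s) (v m * \<psi> m t)"
    using has_bochner_integral_integrable[OF integrable_suminf[OF Fint s1 s2]] by simp
  then show "has_bochner_integral unit_lebesgue (\<lambda>s. K t s * \<psi> m s) (v m * \<psi> m t)"
    by (rule has_bochner_integral_cong[THEN iffD1, rotated -1]) (auto simp: FK)
qed

text \<open>Grouping a convergent series in pairs does not change its value. The lemma serves to compare \<open>cos(x - y) + cos(x - y)\<close>, coming from the frequencies
  \<open>\<plusminus>n\<close>, with \<open>2 cos x cos y + 2 sin x sin y\<close>, coming from two basis functions.\<close>

lemma sums_regroup_pairs:
  fixes f g :: "nat \<Rightarrow> real"
  assumes f: "summable f" and g: "g sums s" and 0: "f 0 = g 0"
    and pairs: "\<And>n. f (2 * n + 1) + f (2 * n + 2) = g (2 * n + 1) + g (2 * n + 2)"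
  shows "f sums s"
proof -
  have grp: "(\<lambda>n. h (2 * n + 1) + h (2 * n + 2)) sums (l - h 0)" if "h sums l" for h :: "nat \<Rightarrow> real" and l
  proof -
    have "(\<lambda>n. h (Suc n)) sums (l - h 0)"
      using that by (simp add: sums_Suc_iff)
    then have "(\<lambda>n. sum (\<lambda>n. h (Suc n)) {n * 2..<n * 2 + 2}) sums (l - h 0)"
      by (rule sums_group) simp
    then show ?thesis by (simp add: mult.commute eval_nat_numeral)
  qed
  show ?thesis
    using grp[OF summable_sums[OF f]] grp[OF g] summable_sums[OF f]
    unfolding pairs 0 using sums_unique2 by fastforce
qed

text \<open>The enumeration \<open>0, 1, -1, 2, -2, \<dots>\<close> of the integers, which places the frequencies \<open>\<plusminus>n\<close> at the
  positions of the cosine and the sine of frequency \<open>n\<close> in the Fourier basis.\<close>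

definition zigzag :: "nat \<Rightarrow> int" where
  "zigzag i = (if odd i then int (Suc i div 2) else - int (Suc i div 2))"

lemma bij_zigzag: "bij zigzag"
proof (rule bij_betw_byWitness[where f' = "\<lambda>n. nat (if n > 0 then 2 * n - 1 else - 2 * n)"])
  show "\<forall>i\<in>UNIV. nat (if zigzag i > 0 then 2 * zigzag i - 1 else - 2 * zigzag i) = i"
    by (auto simp: zigzag_def elim!: oddE evenE)
  show "\<forall>n\<in>UNIV. zigzag (nat (if n > 0 then 2 * n - 1 else - 2 * n)) = n"
    unfolding zigzag_def by (auto simp: even_nat_iff)
qed auto

text \<open>For \<open>k = 1, 2, 3, 4, 5, \<dots>\<close> the frequencies \<open>k div 2\<close> are \<open>0, 1, 1, 2, 2, \<dots>\<close>, which covers the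
  three cases of the eigenvalues uniformly.\<close>

definition sep_eigenvalue :: "real \<Rightarrow> nat \<Rightarrow> real" where
  "sep_eigenvalue a k = sep_weight a (int (k div 2))"

lemma sep_weight_zigzag:
  "a > 0 \<Longrightarrow> sep_weight a (zigzag i) = sep_eigenvalue a (Suc i)"
  by (simp add: zigzag_def sep_eigenvalue_def sep_weight_uminus)

lemma sep_eigenvalue_nonneg: "a > 0 \<Longrightarrow> 0 \<le> sep_eigenvalue a k"
  by (simp add: sep_eigenvalue_def sep_weight_nonneg)

lemma summable_sep_eigenvalue:
  assumes a: "a > 0" shows "summable (\<lambda>i. sep_eigenvalue a (Suc i))"
  using has_sum_imp_sums[OF has_sum_reindex_bij_betw[OF bij_zigzag, THEN iffD2, OF sep_weight_has_sum[OF a]]]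
  unfolding sep_weight_zigzag[OF a] by (rule sums_summable)

lemma sep_kernel_expansion:
  assumes a: "a > 0"
  shows "(\<lambda>i. sep_eigenvalue a (Suc i) * fourier_basis (Suc i) t * fourier_basis (Suc i) s) sums sep_kernel a t s"
proof (rule sums_regroup_pairs)
  define g where "g i = sep_eigenvalue a (Suc i) * cos (2 * pi * of_int (zigzag i) * (t - s))" for i
  show "g sums sep_kernel a t s"
    using has_sum_imp_sums[OF has_sum_reindex_bij_betw[OF bij_zigzag, THEN iffD2, OF sep_phi_has_sum_cos[OF a, of "t - s"]]]
    unfolding sep_weight_zigzag[OF a] sep_kernel_def g_def[abs_def] .
  show "sep_eigenvalue a (Suc 0) * fourier_basis (Suc 0) t * fourier_basis (Suc 0) s = g 0"
    by (simp add: g_def fourier_basis_simps zigzag_def)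
  show "summable (\<lambda>i. sep_eigenvalue a (Suc i) * fourier_basis (Suc i) t * fourier_basis (Suc i) s)"
  proof (rule summable_comparison_test'[OF summable_mult2[OF summable_sep_eigenvalue[OF a], of 2]])
    fix i
    have "\<bar>fourier_basis (Suc i) t\<bar> * \<bar>fourier_basis (Suc i) s\<bar> \<le> sqrt 2 * sqrt 2"
      by (intro mult_mono abs_fourier_basis_le) auto
    then have "\<bar>fourier_basis (Suc i) t\<bar> * \<bar>fourier_basis (Suc i) s\<bar> \<le> 2" by simp
    from mult_left_mono[OF this sep_eigenvalue_nonneg[OF a, of "Suc i"]]
    show "norm (sep_eigenvalue a (Suc i) * fourier_basis (Suc i) t * fourier_basis (Suc i) s) \<le> sep_eigenvalue a (Suc i) * 2"
      using sep_eigenvalue_nonneg[OF a, of "Suc i"] by (simp add: abs_mult mult.assoc)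
  qed
  fix n
  define x y where "x = 2 * pi * real (Suc n) * t" and "y = 2 * pi * real (Suc n) * s"
  have i: "Suc (2 * n + 1) = 2 * Suc n" "Suc (2 * n + 2) = Suc (2 * Suc n)" by simp_all
  have z: "zigzag (2 * n + 1) = int (Suc n)" "zigzag (2 * n + 2) = - int (Suc n)"
    by (simp_all add: zigzag_def)
  have d: "2 * pi * of_int (int (Suc n)) * (t - s) = x - y"
      "2 * pi * of_int (- int (Suc n)) * (t - s) = - (x - y)"
    by (simp_all add: x_def y_def algebra_simps)
  have e: "sep_eigenvalue a (2 * Suc n) = sep_weight a (Suc n)"
      "sep_eigenvalue a (Suc (2 * Suc n)) = sep_weight a (Suc n)"
    by (simp_all add: sep_eigenvalue_def)
  have f: "fourier_basis (2 * Suc n) u = sqrt 2 * cos (2 * pi * real (Suc n) * u)"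
     "fourier_basis (Suc (2 * Suc n)) u = sqrt 2 * sin (2 * pi * real (Suc n) * u)" for u
    by (rule fourier_basis_simps(2), rule fourier_basis_simps(3), simp)
  have r: "sqrt 2 * (sqrt 2 * u) = 2 * u" for u :: real by (simp flip: mult.assoc)
  show "sep_eigenvalue a (Suc (2 * n + 1)) * fourier_basis (Suc (2 * n + 1)) t * fourier_basis (Suc (2 * n + 1)) s +
      sep_eigenvalue a (Suc (2 * n + 2)) * fourier_basis (Suc (2 * n + 2)) t * fourier_basis (Suc (2 * n + 2)) s =
      g (2 * n + 1) + g (2 * n + 2)"
    unfolding g_def z d i e f x_def[symmetric] y_def[symmetric] cos_minus cos_diff
    by (simp add: algebra_simps r)
qed

theorem sep_kernel_karhunen_loeve:
  assumes a: "a > 0"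
  shows "karhunen_loeve_expansion (sep_kernel a) (sep_eigenvalue a) fourier_basis"
  unfolding karhunen_loeve_expansion_def
proof (intro conjI allI impI ballI)
  fix k :: nat assume k: "1 \<le> k"
  show "eigenpair_unit (sep_kernel a) (sep_eigenvalue a k) (fourier_basis k)"
  proof (rule eigenpair_unit_of_expansion[where B = "sqrt 2"])
    show "summable (\<lambda>i. \<bar>sep_eigenvalue a (Suc i)\<bar>)"
      using summable_sep_eigenvalue[OF a] sep_eigenvalue_nonneg[OF a] by simp
  qed (use k in \<open>simp_all add: fourier_basis_orthonormal continuous_fourier_basis abs_fourier_basis_le sep_kernel_expansion[OF a]\<close>)
qed (simp_all add: fourier_basis_orthonormal_basis sep_eigenvalue_nonneg[OF a] sep_kernel_expansion[OF a])

lemma karhunen_loeve_expansion_cong: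
  assumes "\<And>k. k \<ge> 1 \<Longrightarrow> v k = v' k" "\<And>k t. k \<ge> 1 \<Longrightarrow> \<psi> k t = \<psi>' k t"
  shows "karhunen_loeve_expansion K v \<psi> \<longleftrightarrow> karhunen_loeve_expansion K v' \<psi>'"
proof -
  have "\<psi> k = \<psi>' k" if "k \<ge> 1" for k using assms(2)[OF that] by blast
  then show ?thesis
    using assms(1) unfolding karhunen_loeve_expansion_def orthonormal_basis_unit_def by (simp cong: imp_cong)
qed

theorem lemma4p2:
  fixes a :: real and v :: "nat \<Rightarrow> real" and \<psi> :: "nat \<Rightarrow> real \<Rightarrow> real"
  assumes "a > 0"
    and "v 1 = exp (- 2 * a\<^sup>2) * bessel_I 0 (2 * a\<^sup>2)"
    and "\<And>j. j \<ge> 1 \<Longrightarrow> v (2 * j) = exp (- 2 * a\<^sup>2) * bessel_I (int j) (2 * a\<^sup>2)"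
    and "\<And>j. j \<ge> 1 \<Longrightarrow> v (2 * j + 1) = exp (- 2 * a\<^sup>2) * bessel_I (int j) (2 * a\<^sup>2)"
    and "\<And>t. \<psi> 1 t = 1"
    and "\<And>j t. j \<ge> 1 \<Longrightarrow> \<psi> (2 * j) t = sqrt 2 * cos (2 * pi * real j * t)"
    and "\<And>j t. j \<ge> 1 \<Longrightarrow> \<psi> (2 * j + 1) t = sqrt 2 * sin (2 * pi * real j * t)"
  shows "finite_measure (sep_spectral_measure a)
    \<and> distr (sep_spectral_measure a) borel uminus = sep_spectral_measure a
    \<and> (\<forall>t. complex_of_real (sep_phi a t) =
          (\<integral>s. exp (- \<i> * complex_of_real t * complex_of_real s) \<partial>sep_spectral_measure a))
    \<and> karhunen_loeve_expansion (sep_kernel a) v \<psi>"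
proof (intro conjI allI)
  have v: "v k = sep_eigenvalue a k" and \<psi>: "\<psi> k t = fourier_basis k t" if k: "k \<ge> 1" for k t
    by (cases rule: fourier_index_cases[OF k];
        use assms in \<open>simp add: sep_eigenvalue_def sep_weight_def fourier_basis_simps\<close>)+
  show "karhunen_loeve_expansion (sep_kernel a) v \<psi>"
    using sep_kernel_karhunen_loeve[OF assms(1)] 
      karhunen_loeve_expansion_cong[of v "sep_eigenvalue a" \<psi> fourier_basis, OF v \<psi>] by blast
qed (rule finite_measure_sep_spectral_measure[OF assms(1)] distr_uminus_sep_spectral_measure[OF assms(1)]
    sep_phi_spectral_representation[OF assms(1)])+

end
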